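(* Let $\mathcal{A}\in\mathbb{C}^{n\times n\times p}$ be a complex tensor. Then there exist an invertible tensor $\mathcal{P}\in\mathbb{C}^{n\times n\times p}$ and an F-upper-bi-diagonal tensor $\mathcal{J}\in\mathbb{C}^{n\times n\times p}$ such that $$\mathcal{A}=\mathcal{P}^{-1}*\mathcal{J}*\mathcal{P}.$$
   Context: For $\mathcal{A}\in\mathbb{C}^{m\times n\times p}$ let $A^{(1)},\dots,A^{(p)}\in\mathbb{C}^{m\times n}$ be its frontal slices. $\mathrm{bcirc}(\mathcal{A})$ is the $mp\times np$ block circulant matrix whose $(i,j)$ block ($1\le i,j\le p$) is $A^{(((i-j)\bmod p)+1)}$; $\mathrm{unfold}(\mathcal{A})$ is the $mp\times n$ matrix obtained by stacking $A^{(1)},\dots,A^{(p)}$ vertically, and $\mathrm{fold}$ is the inverse of $\mathrm{unfold}$. The T-product of $\mathcal{A}\in\mathbb{C}^{m\times n\times p}$ and $\mathcal{B}\in\mathbb{C}^{n\times s\times p}$ is $\mathcal{A}*\mathcal{B}=\mathrm{fold}(\mathrm{bcirc}(\mathcal{A})\,\mathrm{unfold}(\mathcal{B}))\in\mathbb{C}^{m\times s\times p}$. The identity tensor $\mathcal{I}\in\mathbb{C}^{n\times n\times p}$ has first frontal slice $I_n$ and all other frontal slices zero. $\mathcal{P}\in\mathbb{C}^{n\times n\times p}$ is invertible if there is $\mathcal{P}^{-1}$ with $\mathcal{P}*\mathcal{P}^{-1}=\mathcal{P}^{-1}*\mathcal{P}=\mathcal{I}$. A tensor in $\mathbb{C}^{n\times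 n\times p}$ is F-upper-bi-diagonal if every frontal slice is an upper bidiagonal matrix, i.e. its entries outside the main diagonal and the first superdiagonal vanish. *)

theory Defs
  imports "Jordan_Normal_Form.Matrix"
begin

text \<open>
  A third-order tensor is the list of its frontal slices: the slice \<open>A\<^sup>(\<^sup>k\<^sup>+\<^sup>1\<^sup>)\<close> is \<open>A ! k\<close>.
  The row and column dimensions are read off the first slice, so they are only
  meaningful for at least one slice.
\<close>

type_synonym 'a tensor = "'a mat list"

definition carrier_tensor :: "nat \<Rightarrow> nat \<Rightarrow> nat \<Rightarrow> 'a tensor set" where
  "carrier_tensor m n p = {A. length A = p \<and> set A \<subseteq> carrier_mat m n}"

abbreviation tdim_row :: "'a tensor \<Rightarrow> nat" where
  "tdim_row A \<equiv> dim_row (A ! 0)"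

abbreviation tdim_col :: "'a tensor \<Rightarrow> nat" where
  "tdim_col A \<equiv> dim_col (A ! 0)"

text \<open>
  Block indices start at 0. The subtraction in \<open>bcirc\<close> is on integers, so that
  \<open>mod\<close> wraps around for blocks above the diagonal.
\<close>

definition bcirc :: "'a tensor \<Rightarrow> 'a mat" where
  "bcirc A =
    (let m = tdim_row A; n = tdim_col A; p = length A in
     mat (m * p) (n * p) (\<lambda>(i, j).
       (A ! nat ((int (i div m) - int (j div n)) mod int p)) $$ (i mod m, j mod n)))"

definition t_unfold :: "'a tensor \<Rightarrow> 'a mat" where
  "t_unfold A =
    (let m = tdim_row A in
     mat (m * length A) (tdim_col A) (\<lambda>(i, j). (A ! (i div m)) $$ (i mod m, j)))"

definition t_fold :: "nat \<Rightarrow> nat \<Rightarrow> 'a mat \<Rightarrow> 'a tensor" where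
  "t_fold m p M = map (\<lambda>k. mat m (dim_col M) (\<lambda>(i, j). M $$ (k * m + i, j))) [0..<p]"

lemma t_fold_unfold:
  assumes "A \<in> carrier_tensor m n p"
  shows "t_fold m p (t_unfold A) = A"
proof (rule nth_equalityI)
  show "length (t_fold m p (t_unfold A)) = length A"
    using assms by (simp add: t_fold_def carrier_tensor_def)
next
  fix k assume "k < length (t_fold m p (t_unfold A))"
  then have k: "k < p" by (simp add: t_fold_def)
  have len: "length A = p" using assms by (simp add: carrier_tensor_def)
  have car: "A ! l \<in> carrier_mat m n" if "l < p" for l
    using assms that len nth_mem[of l A] by (auto simp: carrier_tensor_def)
  have c0: "A ! 0 \<in> carrier_mat m n" and ck: "A ! k \<in> carrier_mat m n"
    using car k by auto
  have idx: "k * m + i < m * p" if "i < m" for i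
  proof -
    have "k * m + i < Suc k * m" using that by simp
    also have "\<dots> \<le> p * m" using k by (intro mult_le_mono1) simp
    finally show ?thesis by (simp add: mult.commute)
  qed
  show "t_fold m p (t_unfold A) ! k = A ! k"
    using c0 ck k len idx
    by (intro eq_matI) (auto simp: t_fold_def t_unfold_def Let_def)
qed

lemma t_unfold_fold:
  assumes "0 < p" and "M \<in> carrier_mat (m * p) n"
  shows "t_unfold (t_fold m p M) = M"
proof (rule eq_matI)
  fix i j assume ij: "i < dim_row M" "j < dim_col M"
  then have i: "i < m * p" using assms by auto
  then have "0 < m" by (cases m) auto
  moreover have "i div m < p" using i by (simp add: less_mult_imp_div_less mult.commute)
  ultimately show "t_unfold (t_fold m p M) $$ (i, j) = M $$ (i, j)"
    using assms i ij by (simp add: t_fold_def t_unfold_def Let_def)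
qed (use assms in \<open>auto simp: t_fold_def t_unfold_def Let_def\<close>)

definition t_prod :: "'a::semiring_0 tensor \<Rightarrow> 'a tensor \<Rightarrow> 'a tensor"  (infixl "*\<^sub>t" 70) where
  "A *\<^sub>t B = t_fold (tdim_row A) (length A) (bcirc A * t_unfold B)"

definition id_tensor :: "nat \<Rightarrow> nat \<Rightarrow> 'a::{zero,one} tensor" where
  "id_tensor n p = map (\<lambda>k. if k = 0 then 1\<^sub>m n else 0\<^sub>m n n) [0..<p]"

definition t_inverse_of :: "nat \<Rightarrow> nat \<Rightarrow> 'a::semiring_1 tensor \<Rightarrow> 'a tensor \<Rightarrow> bool" where
  "t_inverse_of n p P Q \<longleftrightarrow>
     Q \<in> carrier_tensor n n p \<and> P *\<^sub>t Q = id_tensor n p \<and> Q *\<^sub>t P = id_tensor n p"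

definition upper_bidiagonal :: "'a::zero mat \<Rightarrow> bool" where
  "upper_bidiagonal M \<longleftrightarrow>
     (\<forall>i < dim_row M. \<forall>j < dim_col M. j \<noteq> i \<and> j \<noteq> Suc i \<longrightarrow> M $$ (i, j) = 0)"

definition F_upper_bidiagonal :: "'a::zero tensor \<Rightarrow> bool" where
  "F_upper_bidiagonal A \<longleftrightarrow> (\<forall>M \<in> set A. upper_bidiagonal M)"

end

theory Submission
  imports Defs "Jordan_Normal_Form.Jordan_Normal_Form_Existence"
begin

text \<open>
  The T-product is circular convolution of the sequences of frontal slices, with matrix
  multiplication in place of scalar multiplication. The discrete Fourier transform along the
  slices therefore turns it into a pointwise product: for each \<open>p\<close>-th root of unity \<open>z\<close>, the
  matrices \<open>\<Sum>k<p. z\<^sup>-\<^sup>k A\<^sup>(\<^sup>k\<^sup>+\<^sup>1\<^sup>)\<close> multiply independently of each other.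

  So one brings the Fourier coefficient at each \<open>z\<close> to Jordan normal form over the complex numbers
  and transforms the similarity matrices, their inverses and the Jordan matrices back. Each slice
  of the resulting \<open>J\<close> is a linear combination of Jordan matrices, which are upper bidiagonal, and
  being upper bidiagonal is a linear condition.

  The development works with the inverse transform \<open>spectral_tensor\<close>, which builds a tensor from
  prescribed Fourier coefficients. Three facts suffice: it is multiplicative
  (\<open>t_prod_spectral_tensor\<close>), it sends the constant family of identity matrices to the identity
  tensor (\<open>id_tensor_eq_spectral_tensor\<close>), and it reaches every tensor
  (\<open>tensor_eq_spectral_tensor\<close>). They come from the two orthogonality relations for roots of unity.
\<close>

section \<open>Roots of unity\<close>

lemma power_nat_mod_root_unity:
  fixes z :: complex
  assumes "0 < p" and "z ^ p = 1"
  shows "z ^ nat (x mod int p) = z powi x"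
proof -
  have "z \<noteq> 0" using assms by (auto simp: power_0_left)
  have "z powi x = z powi (int p * (x div int p) + x mod int p)" by simp
  also have "\<dots> = (z powi int p) powi (x div int p) * z powi (x mod int p)"
    by (simp only: power_int_add[OF disjI1[OF \<open>z \<noteq> 0\<close>]] power_int_mult)
  also have "\<dots> = z powi (x mod int p)" using assms by simp
  also have "\<dots> = z ^ nat (x mod int p)"
    using assms by (simp add: power_int_def)
  finally show ?thesis by simp
qed

text \<open>Orthogonality of characters: a geometric sum whose ratio \<open>y / z\<close> is itself a \<open>p\<close>-th root of 1.\<close>

lemma sum_power_quotient_roots_unity:
  fixes y z :: complex
  assumes "y ^ p = 1" and "z ^ p = 1" and "0 < p"
  shows "(\<Sum>l<p. y ^ l / z ^ l) = (if y = z then of_nat p else 0)"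
proof -
  have "z \<noteq> 0" using assms by (auto simp: power_0_left)
  then have "y / z = 1 \<longleftrightarrow> y = z" by simp
  moreover have "(y / z) ^ p = 1" using assms by (simp add: power_divide)
  ultimately show ?thesis
    by (auto simp: power_divide[symmetric] sum_gp_strict)
qed

text \<open>
  Dual orthogonality: multiplication by a primitive root \<open>w\<close> permutes the roots of unity and
  multiplies the sum by \<open>w powi x\<close>, which differs from 1 unless \<open>p\<close> divides \<open>x\<close>; in the given
  range that means \<open>x = 0\<close>.
\<close>

lemma sum_powi_roots_unity:
  fixes p :: nat and x :: int
  assumes "0 < p" and "\<bar>x\<bar> < int p"
  shows "(\<Sum>z | z ^ p = 1. z powi x) = (if x = 0 then of_nat p else (0::complex))"
proof (cases "x = 0")
  case True
  then show ?thesis using card_roots_unity_eq[OF assms(1)] by simp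
next
  case False
  define w where "w = cis (2 * pi / p)"
  let ?R = "{z::complex. z ^ p = 1}"
  have w0: "w \<noteq> 0" by (simp add: w_def)
  have wp: "w ^ p = 1" using assms by (simp add: w_def DeMoivre)
  have powi_ne: "w powi x \<noteq> 1"
  proof
    assume "w powi x = 1"
    then have "w ^ nat (x mod int p) = 1"
      using power_nat_mod_root_unity[OF assms(1) wp] by simp
    moreover have "w ^ m = cis (2 * pi * real m / real p)" for m
      by (simp add: w_def DeMoivre mult_ac)
    ultimately have "cis (2 * pi * real (nat (x mod int p)) / real p) = cis (2 * pi * real 0 / real p)"
      by (metis power_0)
    moreover have "nat (x mod int p) < p" using assms(1) by (simp add: nat_less_iff)
    ultimately have "nat (x mod int p) = 0"
      using inj_onD[OF bij_betw_imp_inj_on[OF Complex.bij_betw_roots_unity[OF assms(1)]]] assms(1)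
      by blast
    moreover have "0 \<le> x mod int p" using assms(1) by simp
    ultimately have "int p dvd x" by auto
    then show False using False assms(2) dvd_imp_le_int[of x "int p"] by simp
  qed
  have bij: "bij_betw (\<lambda>z. w * z) ?R ?R"
    by (rule bij_betw_byWitness[where f' = "\<lambda>z. z / w"])
      (use w0 wp in \<open>auto simp: power_mult_distrib power_divide\<close>)
  have "(\<Sum>z\<in>?R. z powi x) = (\<Sum>z\<in>?R. (w * z) powi x)"
    using sum.reindex_bij_betw[OF bij, of "\<lambda>z. z powi x"] by simp
  also have "\<dots> = w powi x * (\<Sum>z\<in>?R. z powi x)"
    by (simp add: power_int_mult_distrib sum_distrib_left)
  finally show ?thesis using powi_ne False by simp
qed

section \<open>The T-product as a circular convolution\<close>

lemma carrier_tensor_nth: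
  "A \<in> carrier_tensor m n p \<Longrightarrow> k < p \<Longrightarrow> A ! k \<in> carrier_mat m n"
  by (auto simp: carrier_tensor_def)

lemma carrier_tensor_length: "A \<in> carrier_tensor m n p \<Longrightarrow> length A = p"
  by (simp add: carrier_tensor_def)

lemma tensor_eqI:
  assumes "A \<in> carrier_tensor m n p" and "B \<in> carrier_tensor m n p"
    and "\<And>k i j. k < p \<Longrightarrow> i < m \<Longrightarrow> j < n \<Longrightarrow> A ! k $$ (i, j) = B ! k $$ (i, j)"
  shows "A = B"
proof (rule nth_equalityI)
  show "length A = length B" using assms by (simp add: carrier_tensor_length)
  fix k assume "k < length A"
  then have "k < p" using assms(1) by (simp add: carrier_tensor_length)
  from assms(1,2)[THEN carrier_tensor_nth, OF this] assms(3)[OF this]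
  show "A ! k = B ! k" by (intro eq_matI) auto
qed

lemma t_prod_carrier:
  assumes "A \<in> carrier_tensor m n p" and "B \<in> carrier_tensor n s p" and "0 < p"
  shows "A *\<^sub>t B \<in> carrier_tensor m s p"
  using carrier_tensor_nth[OF assms(1,3)] carrier_tensor_nth[OF assms(2,3)]
    carrier_tensor_length[OF assms(1)]
  by (auto simp: carrier_tensor_def t_prod_def t_fold_def t_unfold_def Let_def)

lemma t_prod_index:
  fixes A B :: "'a::semiring_0 tensor"
  assumes A: "A \<in> carrier_tensor m n p" and B: "B \<in> carrier_tensor n s p"
    and k: "k < p" and i: "i < m" and j: "j < s"
  shows "(A *\<^sub>t B) ! k $$ (i, j) =
    (\<Sum>l<p. \<Sum>r<n. A ! nat ((int k - int l) mod int p) $$ (i, r) * B ! l $$ (r, j))"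
proof -
  from k have p: "0 < p" by simp
  note dims = carrier_tensor_nth[OF A p] carrier_tensor_nth[OF B p]
    carrier_tensor_length[OF A] carrier_tensor_length[OF B]
  have row: "k * m + i < m * p"
  proof -
    have "k * m + i < Suc k * m" using i by simp
    also have "\<dots> \<le> p * m" using k by (intro mult_le_mono1) simp
    finally show ?thesis by (simp add: mult.commute)
  qed
  have entry: "(bcirc A * t_unfold B) $$ (k * m + i, j) =
      (\<Sum>q<p * n. A ! nat ((int k - int (q div n)) mod int p) $$ (i, q mod n)
        * B ! (q div n) $$ (q mod n, j))"
    using dims row i j
    by (simp add: bcirc_def t_unfold_def Let_def scalar_prod_def atLeast0LessThan mult.commute)
  \<comment> \<open>The column index \<open>q\<close> of the block circulant matrix is \<open>l * n + r\<close>.\<close>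
  have block: "(\<Sum>q\<in>{l * n..<l * n + n}. A ! nat ((int k - int (q div n)) mod int p) $$ (i, q mod n)
        * B ! (q div n) $$ (q mod n, j)) =
      (\<Sum>r<n. A ! nat ((int k - int l) mod int p) $$ (i, r) * B ! l $$ (r, j))" for l
  proof (rule sum.reindex_bij_witness[of _ "\<lambda>r. l * n + r" "\<lambda>q. q - l * n"])
    fix q assume q: "q \<in> {l * n..<l * n + n}"
    then have "q div n = l" by (intro div_nat_eqI) (auto simp: mult.commute)
    moreover from this have "q mod n = q - l * n" by (metis minus_div_mult_eq_mod)
    ultimately show "A ! nat ((int k - int l) mod int p) $$ (i, q - l * n) * B ! l $$ (q - l * n, j) =
      A ! nat ((int k - int (q div n)) mod int p) $$ (i, q mod n) * B ! (q div n) $$ (q mod n, j)"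
      by simp
  qed auto
  have "(A *\<^sub>t B) ! k $$ (i, j) = (bcirc A * t_unfold B) $$ (k * m + i, j)"
    using dims k i j by (simp add: t_prod_def t_fold_def t_unfold_def Let_def)
  then show ?thesis
    unfolding entry sum.nat_group[symmetric] block .
qed

section \<open>The Fourier transform along the slices\<close>

text \<open>
  The Fourier coefficients are indexed by the roots of unity themselves instead of by
  exponents of a chosen primitive root. The factor \<open>1 / p\<close> is put into \<open>spectral_tensor\<close>,
  the inverse transform; this normalisation makes it multiplicative.
\<close>

definition spectral_tensor :: "nat \<Rightarrow> nat \<Rightarrow> (complex \<Rightarrow> complex mat) \<Rightarrow> complex tensor" where
  "spectral_tensor n p F =
     map (\<lambda>k. mat n n (\<lambda>(i, j). (\<Sum>z | z ^ p = 1. z ^ k * F z $$ (i, j)) / of_nat p)) [0..<p]"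

definition fourier_coeff :: "nat \<Rightarrow> complex tensor \<Rightarrow> complex \<Rightarrow> complex mat" where
  "fourier_coeff n A z = mat n n (\<lambda>(i, j). \<Sum>l<length A. A ! l $$ (i, j) / z ^ l)"

lemma spectral_tensor_carrier: "spectral_tensor n p F \<in> carrier_tensor n n p"
  by (auto simp: spectral_tensor_def carrier_tensor_def)

lemma spectral_tensor_index:
  assumes "k < p" and "i < n" and "j < n"
  shows "spectral_tensor n p F ! k $$ (i, j) = (\<Sum>z | z ^ p = 1. z ^ k * F z $$ (i, j)) / of_nat p"
  using assms by (simp add: spectral_tensor_def)

lemma spectral_tensor_cong:
  assumes "\<And>z. z ^ p = 1 \<Longrightarrow> F z = G z"
  shows "spectral_tensor n p F = spectral_tensor n p G"
  by (simp add: spectral_tensor_def assms)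

text \<open>
  Since \<open>z ^ p = 1\<close>, the slice index of the first factor, reduced modulo \<open>p\<close>, contributes
  \<open>z ^ k / z ^ l\<close>. The only other dependence on \<open>l\<close> is the factor \<open>y ^ l\<close> of the second
  tensor, so summing over \<open>l\<close> first leaves the terms with \<open>y = z\<close>.
\<close>

lemma t_prod_spectral_tensor:
  assumes F: "\<And>z. z ^ p = 1 \<Longrightarrow> F z \<in> carrier_mat n n"
    and G: "\<And>z. z ^ p = 1 \<Longrightarrow> G z \<in> carrier_mat n n" and p: "0 < p"
  shows "spectral_tensor n p F *\<^sub>t spectral_tensor n p G = spectral_tensor n p (\<lambda>z. F z * G z)"
proof (rule tensor_eqI)
  let ?R = "{z::complex. z ^ p = 1}"
  have fin: "finite ?R" using p by (intro finite_roots_unity) simp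
  show "spectral_tensor n p F *\<^sub>t spectral_tensor n p G \<in> carrier_tensor n n p"
    by (rule t_prod_carrier[OF spectral_tensor_carrier spectral_tensor_carrier p])
  show "spectral_tensor n p (\<lambda>z. F z * G z) \<in> carrier_tensor n n p"
    by (rule spectral_tensor_carrier)
  fix k i j assume k: "k < p" and i: "i < n" and j: "j < n"
  have wrap: "z ^ nat ((int k - int l) mod int p) = z ^ k / z ^ l" if "z \<in> ?R" for z :: complex and l
  proof -
    have "z \<noteq> 0" using that p by (auto simp: power_0_left)
    then show ?thesis using that p by (simp add: power_nat_mod_root_unity power_int_diff)
  qed
  have left: "spectral_tensor n p F ! nat ((int k - int l) mod int p) $$ (i, r) =
      (\<Sum>z\<in>?R. z ^ k / z ^ l * F z $$ (i, r)) / of_nat p" if "r < n" for l r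
    using that i p by (subst spectral_tensor_index) (auto simp: nat_less_iff wrap intro!: sum.cong)
  have product: "(\<Sum>z\<in>?R. f z) / of_nat p * ((\<Sum>y\<in>?R. g y) / of_nat p) =
      (\<Sum>z\<in>?R. \<Sum>y\<in>?R. f z * g y / (of_nat p * of_nat p))" for f g :: "complex \<Rightarrow> complex"
    by (simp add: sum_product sum_divide_distrib)
  have "(spectral_tensor n p F *\<^sub>t spectral_tensor n p G) ! k $$ (i, j) =
      (\<Sum>l<p. \<Sum>r<n. \<Sum>z\<in>?R. \<Sum>y\<in>?R.
        (y ^ l / z ^ l) * (z ^ k * F z $$ (i, r) * G y $$ (r, j) / (of_nat p * of_nat p)))"
    unfolding t_prod_index[OF spectral_tensor_carrier spectral_tensor_carrier k i j]
    by (intro sum.cong refl)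
      (simp only: left spectral_tensor_index j product lessThan_iff, simp add: mult_ac)
  also have "\<dots> = (\<Sum>r<n. \<Sum>l<p. \<Sum>z\<in>?R. \<Sum>y\<in>?R.
        (y ^ l / z ^ l) * (z ^ k * F z $$ (i, r) * G y $$ (r, j) / (of_nat p * of_nat p)))"
    by (rule sum.swap)
  also have "\<dots> = (\<Sum>r<n. \<Sum>z\<in>?R. \<Sum>l<p. \<Sum>y\<in>?R.
        (y ^ l / z ^ l) * (z ^ k * F z $$ (i, r) * G y $$ (r, j) / (of_nat p * of_nat p)))"
    by (intro sum.cong refl sum.swap)
  also have "\<dots> = (\<Sum>r<n. \<Sum>z\<in>?R. \<Sum>y\<in>?R. \<Sum>l<p.
        (y ^ l / z ^ l) * (z ^ k * F z $$ (i, r) * G y $$ (r, j) / (of_nat p * of_nat p)))"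
    by (intro sum.cong refl sum.swap)
  also have "\<dots> = (\<Sum>r<n. \<Sum>z\<in>?R. \<Sum>y\<in>?R. (if y = z then of_nat p else 0) *
        (z ^ k * F z $$ (i, r) * G y $$ (r, j) / (of_nat p * of_nat p)))"
    using p by (intro sum.cong refl)
      (simp only: sum_distrib_right[symmetric] sum_power_quotient_roots_unity mem_Collect_eq)
  also have "\<dots> = (\<Sum>r<n. \<Sum>z\<in>?R. z ^ k * F z $$ (i, r) * G z $$ (r, j) / of_nat p)"
    using p fin by (intro sum.cong refl) (simp add: if_distribR if_distrib[of "\<lambda>c. c * _"] if_distrib[of "\<lambda>c. c / _"] cong: if_cong)
  also have "\<dots> = (\<Sum>z\<in>?R. \<Sum>r<n. z ^ k * F z $$ (i, r) * G z $$ (r, j) / of_nat p)"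
    by (rule sum.swap)
  also have "\<dots> = (\<Sum>z\<in>?R. z ^ k * (F z * G z) $$ (i, j) / of_nat p)"
  proof (intro sum.cong refl)
    fix z assume "z \<in> ?R"
    then have "(F z * G z) $$ (i, j) = (\<Sum>r<n. F z $$ (i, r) * G z $$ (r, j))"
      using F[of z] G[of z] i j by (simp add: scalar_prod_def atLeast0LessThan)
    then show "(\<Sum>r<n. z ^ k * F z $$ (i, r) * G z $$ (r, j) / of_nat p) =
        z ^ k * (F z * G z) $$ (i, j) / of_nat p"
      by (simp add: sum_distrib_left sum_divide_distrib mult_ac)
  qed
  also have "\<dots> = spectral_tensor n p (\<lambda>z. F z * G z) ! k $$ (i, j)"
    using k i j by (simp add: spectral_tensor_index sum_divide_distrib)
  finally show "(spectral_tensor n p F *\<^sub>t spectral_tensor n p G) ! k $$ (i, j) =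
    spectral_tensor n p (\<lambda>z. F z * G z) ! k $$ (i, j)" .
qed

lemma id_tensor_eq_spectral_tensor:
  assumes "0 < p"
  shows "id_tensor n p = spectral_tensor n p (\<lambda>_. 1\<^sub>m n)"
proof (rule tensor_eqI[OF _ spectral_tensor_carrier])
  show "id_tensor n p \<in> carrier_tensor n n p"
    by (auto simp: id_tensor_def carrier_tensor_def)
  fix k i j assume k: "k < p" and "i < n" and "j < n"
  moreover have "(\<Sum>z | z ^ p = 1. z ^ k) = (if k = 0 then of_nat p else (0::complex))"
    using sum_powi_roots_unity[OF assms, of "int k"] k by simp
  ultimately show "id_tensor n p ! k $$ (i, j) = spectral_tensor n p (\<lambda>_. 1\<^sub>m n) ! k $$ (i, j)"
    using assms by (simp add: id_tensor_def spectral_tensor_index card_roots_unity_eq)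
qed

text \<open>
  Fourier inversion: the dual orthogonality isolates the slice with \<open>l = k\<close>, because
  \<open>k - l\<close> lies strictly between \<open>- p\<close> and \<open>p\<close>.
\<close>

lemma tensor_eq_spectral_tensor:
  assumes A: "A \<in> carrier_tensor n n p" and p: "0 < p"
  shows "A = spectral_tensor n p (fourier_coeff n A)"
proof (rule tensor_eqI[OF A spectral_tensor_carrier])
  let ?R = "{z::complex. z ^ p = 1}"
  fix k i j assume k: "k < p" and i: "i < n" and j: "j < n"
  have quotient: "z ^ k / z ^ l = z powi (int k - int l)" if "z \<in> ?R" for z :: complex and l
  proof -
    have "z \<noteq> 0" using that p by (auto simp: power_0_left)
    then show ?thesis by (simp add: power_int_diff)
  qed
  have "(\<Sum>z\<in>?R. z ^ k * fourier_coeff n A z $$ (i, j)) =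
      (\<Sum>z\<in>?R. \<Sum>l<p. A ! l $$ (i, j) * (z ^ k / z ^ l))"
    using i j by (simp add: fourier_coeff_def carrier_tensor_length[OF A] sum_distrib_left mult_ac)
  also have "\<dots> = (\<Sum>l<p. \<Sum>z\<in>?R. A ! l $$ (i, j) * (z ^ k / z ^ l))"
    by (rule sum.swap)
  also have "\<dots> = (\<Sum>l<p. A ! l $$ (i, j) * (\<Sum>z\<in>?R. z powi (int k - int l)))"
    unfolding sum_distrib_left
    by (intro sum.cong refl) (simp add: quotient del: times_divide_eq_right)
  also have "\<dots> = (\<Sum>l<p. A ! l $$ (i, j) * (if l = k then of_nat p else 0))"
    using k p by (intro sum.cong refl) (simp add: sum_powi_roots_unity)
  also have "\<dots> = A ! k $$ (i, j) * of_nat p"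
    using k by (simp add: if_distrib[of "\<lambda>c. _ * c"] cong: if_cong)
  finally show "A ! k $$ (i, j) = spectral_tensor n p (fourier_coeff n A) ! k $$ (i, j)"
    using k i j p by (simp add: spectral_tensor_index)
qed

section \<open>Jordan forms of the Fourier coefficients\<close>

lemma upper_bidiagonal_jordan_matrix: "upper_bidiagonal (jordan_matrix n_as)"
proof (induction n_as)
  case Nil
  then show ?case by (simp add: upper_bidiagonal_def jordan_matrix_def)
next
  case (Cons na n_as)
  obtain a b where na: "na = (a, b)" by (cases na)
  have "jordan_matrix n_as $$ (i - a, j - a) = 0"
    if "a \<le> i" "a \<le> j" "j \<noteq> i" "j \<noteq> Suc i" "i < a + sum_list (map fst n_as)"
      "j < a + sum_list (map fst n_as)" for i j
  proof -
    from that have "i - a < sum_list (map fst n_as)" "j - a < sum_list (map fst n_as)"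
      "j - a \<noteq> i - a" "j - a \<noteq> Suc (i - a)"
      by arith+
    with Cons.IH show ?thesis by (simp add: upper_bidiagonal_def)
  qed
  then show ?case
    by (auto simp: na upper_bidiagonal_def jordan_matrix_Cons)
qed

lemma similar_upper_bidiagonal_complex:
  fixes A :: "complex mat"
  assumes A: "A \<in> carrier_mat n n"
  obtains P Q J where "P \<in> carrier_mat n n" "Q \<in> carrier_mat n n" "J \<in> carrier_mat n n"
    "P * Q = 1\<^sub>m n" "Q * P = 1\<^sub>m n" "upper_bidiagonal J" "A = Q * J * P"
proof -
  obtain as where "char_poly A = (\<Prod>a\<leftarrow>as. [:- a, 1:])"
    using char_poly_factorized[OF A] by blast
  then obtain n_as where "jordan_nf A n_as" using jordan_nf_exists[OF A] by blast
  then obtain Q P where "similar_mat_wit A (jordan_matrix n_as) Q P"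
    by (auto simp: jordan_nf_def similar_mat_def)
  from similar_mat_witD2[OF A this] that upper_bidiagonal_jordan_matrix show ?thesis by blast
qed

text \<open>Every slice is a linear combination of the Fourier coefficients.\<close>

lemma F_upper_bidiagonal_spectral_tensor:
  assumes "\<And>z. z ^ p = 1 \<Longrightarrow> F z \<in> carrier_mat n n"
    and "\<And>z. z ^ p = 1 \<Longrightarrow> upper_bidiagonal (F z)"
  shows "F_upper_bidiagonal (spectral_tensor n p F)"
proof -
  have "F z $$ (i, j) = 0" if "z ^ p = 1" "i < n" "j < n" "j \<noteq> i" "j \<noteq> Suc i" for z i j
    using assms[OF that(1)] that(2-) by (auto simp: upper_bidiagonal_def)
  then show ?thesis
    by (auto simp: F_upper_bidiagonal_def upper_bidiagonal_def spectral_tensor_def)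
qed

theorem theorem1:
  fixes A :: "complex tensor" and n p :: nat
  assumes "0 < n" and "0 < p"
    and "A \<in> carrier_tensor n n p"
  shows "\<exists>P \<in> carrier_tensor n n p. \<exists>Pinv J.
           t_inverse_of n p P Pinv \<and>
           J \<in> carrier_tensor n n p \<and> F_upper_bidiagonal J \<and>
           A = Pinv *\<^sub>t J *\<^sub>t P"
proof -
  let ?S = "spectral_tensor n p"
  have "\<forall>z. \<exists>P Q J. P \<in> carrier_mat n n \<and> Q \<in> carrier_mat n n \<and> J \<in> carrier_mat n n \<and>
      P * Q = 1\<^sub>m n \<and> Q * P = 1\<^sub>m n \<and> upper_bidiagonal J \<and> fourier_coeff n A z = Q * J * P"
  proof
    fix z
    have "fourier_coeff n A z \<in> carrier_mat n n" by (simp add: fourier_coeff_def)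
    from similar_upper_bidiagonal_complex[OF this]
    show "\<exists>P Q J. P \<in> carrier_mat n n \<and> Q \<in> carrier_mat n n \<and> J \<in> carrier_mat n n \<and>
      P * Q = 1\<^sub>m n \<and> Q * P = 1\<^sub>m n \<and> upper_bidiagonal J \<and> fourier_coeff n A z = Q * J * P"
      by metis
  qed
  then obtain P Q J where
    P: "\<And>z. P z \<in> carrier_mat n n" and Q: "\<And>z. Q z \<in> carrier_mat n n" and
    J: "\<And>z. J z \<in> carrier_mat n n" and
    PQ: "\<And>z. P z * Q z = 1\<^sub>m n" and QP: "\<And>z. Q z * P z = 1\<^sub>m n" and
    bidiag: "\<And>z. upper_bidiagonal (J z)" and
    decomp: "\<And>z. fourier_coeff n A z = Q z * J z * P z"
    by metis
  note QJ = mult_carrier_mat[OF Q J]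
  have "t_inverse_of n p (?S P) (?S Q)"
    using assms(2) by (simp add: t_inverse_of_def spectral_tensor_carrier
        t_prod_spectral_tensor P Q PQ QP id_tensor_eq_spectral_tensor)
  moreover have "F_upper_bidiagonal (?S J)"
    by (rule F_upper_bidiagonal_spectral_tensor[OF J bidiag])
  moreover have "A = ?S Q *\<^sub>t ?S J *\<^sub>t ?S P"
  proof -
    have "A = ?S (fourier_coeff n A)"
      by (rule tensor_eq_spectral_tensor[OF assms(3,2)])
    also have "\<dots> = ?S (\<lambda>z. Q z * J z * P z)"
      by (rule spectral_tensor_cong[OF decomp])
    also have "\<dots> = ?S Q *\<^sub>t ?S J *\<^sub>t ?S P"
      using assms(2) by (simp add: t_prod_spectral_tensor P Q J QJ)
    finally show ?thesis .
  qed
  ultimately show ?thesis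
    using spectral_tensor_carrier by blast
qed

end
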